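(* The tableau calculus $\mathbf{TAB}_{\mathbf{TO}}$ is complete for the class of all totally ordered (TO) models; that is, every formula $\varphi$ that is true at every world of every TO model is provable in $\mathbf{TAB}_{\mathbf{TO}}$.
   Context: **Formulas.** Let $\mathbf{Prop}$ (propositional variables) and $\mathbf{Nom}$ (nominals) be disjoint countably infinite sets. Formulas are $\varphi ::= p \mid i \mid \neg\varphi \mid \varphi\land\varphi \mid \varphi\lor\varphi \mid \Diamond\varphi \mid \Box\varphi \mid @_i\varphi$ with $p\in\mathbf{Prop}$, $i\in\mathbf{Nom}$. All formulas are taken in negation normal form (NNF: negation only in front of propositional variables and nominals; $\neg @_i\varphi$ is rewritten as $@_i\neg\varphi$, Boolean and modal operators as usual), and $\neg\varphi$ denotes the NNF of the negation of $\varphi$. **Semantics.** A model $\mathcal M=(W,R,V)$ has a non-empty set $W$, a binary relation $R$ on $W$, and $V:\mathbf{Prop}\cup\mathbf{Nom}\to\mathcal P(W)$ with $V(i)=\{i^V\}$ a singleton for each $i\in\mathbf{Nom}$. Satisfaction: $\mathcal M,w\models p$ iff $w\in V(p)$; $\mathcal M,w\models i$ iff $w=i^V$; Boolean connectives as usual; $\mathcal M,w\models\Diamond\varphi$ iff $\mathcal M,v\models\varphi$ for some $v$ with $wRv$; $\mathcal M,w\models\Box\varphi$ iff $\mathcal M,v\models\varphi$ for all $v$ with $wRv$; $\mathcal M,w\models@_i\varphi$ iff $\mathcal M,i^V\models\varphi$. A TO model is a model whose $R$ is a total order: reflexive, anti-symmetric, transitive and total ($\forall x,y$: $xRy$ or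 $yRx$). **Tableaus.** A tableau is a tree of formulas, built downwards from a root formula $@_i\varphi$, where $i\in\mathbf{Nom}$ does not occur in $\varphi$, by extending branches with the rules below (branches may a priori be infinite). We write $\varphi\in\Theta$ if $\varphi$ occurs in the branch $\Theta$. A branch $\Theta$ is closed if $@_i\varphi, @_i\neg\varphi\in\Theta$ for some $\varphi$, $i$; otherwise it is open. A tableau is closed if all its branches are closed. A closed branch is not extended, nor is a branch on which every formula that could be generated by applying a rule already exists; rules are not applied redundantly: each application must add a formula not already on the branch to every branch it produces. A formula $\varphi$ is provable if there is a closed tableau with root formula $@_i\neg\varphi$, where $i\in\mathbf{Nom}$ does not occur in $\varphi$. **Rules of $\mathbf{TAB}_{\mathbf{TO}}$** (premises are on the branch; conclusions are added to it). "Accessibility formula" means a formula $@_i\Diamond j$ added by $[\Diamond]$ (with $j$ new), a formula $@_i\Diamond i$ added by $[Ref]$, or a formula $@_i\Diamond j$ or $@_j\Diamond i$ added by $[Tot]$. - $[Eq]$: add $@_i i$, for any nominal $i$ already occurring in the branch. - $[\land]$: from $@_i(\varphi\land\psi)$ add $@_i\varphi$ and $@_i\psi$. - $[\lor]$: from $@_i(\varphi\lor\psi)$ split the branch, adding $@_i\varphi$ on one side and $@_i\psi$ on the other. - $[\Diamond]$: from $@_i\Diamond\varphi$ which is not an accessibility formula, add $@_i\Diamond j$ and $@_j\varphi$, where $j$ is a nominal not occurring in the branch; it is applied at most once per formula. - $[\Box]$: from $@_i\Box\varphi$ and $@_i\Diamond j$ add $@_j\varphi$. - $[@]$: from $@_i@_j\varphi$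 add $@_j\varphi$. - $[Id]$: from $@_i\varphi$, not an accessibility formula, and $@_i j$ add $@_j\varphi$. - $[Ref]$: add $@_i\Diamond i$, for any nominal $i$ already occurring in the branch. - $[A\text{-}sym]$: add $@_i\Box(i\lor\Box\neg i)$, for any nominal $i$ already occurring in the branch. - $[Trs]$: from $@_i\Box\varphi$ and $@_i\Diamond j$ add $@_j\Box\varphi$. - $[Tot]$: for any nominals $i,j$ already occurring in the branch, split the branch, adding $@_i\Diamond j$ on one side and $@_j\Diamond i$ on the other. - Restriction $(\mathcal D)$: $[\Diamond]$ can be applied to $@_i\Diamond\varphi$ on a branch $\Theta$ only if $i$ is a quasi-urfather on $\Theta$ (at the moment of application). **Quasi-urfathers.** $@_i\varphi$ is a prefixed subformula of $@_j\psi$ if $\varphi$ is a subformula of $\psi$. For a nominal $i$ occurring in $\Theta$, $T^\Theta(i)=T_1^\Theta(i)\cup T_2^\Theta(i)$, where $T_1^\Theta(i)$ is the set of $\varphi$ such that $@_i\varphi\in\Theta$ is a prefixed subformula of the root formula of $\Theta$, and $T_2^\Theta(i)$ is the set of $\psi$ such that $@_i\psi\in\Theta$ is a prefixed subformula of $@_j\Box(j\lor\Box\neg j)$ for some $j$ occurring in the root formula. Nominals $i,j$ are twins in $\Theta$ if $T^\Theta(i)=T^\Theta(j)$. Write $i\prec_\Theta j$ if $j$ is introduced in $\Theta$ by applying $[\Diamond]$ to some $@_i\Diamond\varphi$; $\prec_\Theta^*$ is the reflexive transitive closure. A nominal $i$ is a quasi-urfather on $\Theta$ if there are no twins $j\neq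 k$ with $j\prec_\Theta^* i$ and $k\prec_\Theta^* i$. *)

theory Defs
  imports Main
begin

type_synonym prp = nat
type_synonym nom = nat

datatype form =
    Pro prp
  | Nom nom
  | Neg form
  | And form form
  | Or form form
  | Dia form
  | Box form
  | At nom form

fun nnf :: "form \<Rightarrow> form" where
  "nnf (Pro p) = Pro p"
| "nnf (Nom i) = Nom i"
| "nnf (And f g) = And (nnf f) (nnf g)"
| "nnf (Or f g) = Or (nnf f) (nnf g)"
| "nnf (Dia f) = Dia (nnf f)"
| "nnf (Box f) = Box (nnf f)"
| "nnf (At i f) = At i (nnf f)"
| "nnf (Neg (Pro p)) = Neg (Pro p)"
| "nnf (Neg (Nom i)) = Neg (Nom i)"
| "nnf (Neg (Neg f)) = nnf f"
| "nnf (Neg (And f g)) = Or (nnf (Neg f)) (nnf (Neg g))"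
| "nnf (Neg (Or f g)) = And (nnf (Neg f)) (nnf (Neg g))"
| "nnf (Neg (Dia f)) = Box (nnf (Neg f))"
| "nnf (Neg (Box f)) = Dia (nnf (Neg f))"
| "nnf (Neg (At i f)) = At i (nnf (Neg f))"

definition neg :: "form \<Rightarrow> form" where
  "neg f = nnf (Neg f)"

primrec noms :: "form \<Rightarrow> nom set" where
  "noms (Pro p) = {}"
| "noms (Nom i) = {i}"
| "noms (Neg f) = noms f"
| "noms (And f g) = noms f \<union> noms g"
| "noms (Or f g) = noms f \<union> noms g"
| "noms (Dia f) = noms f"
| "noms (Box f) = noms f"
| "noms (At i f) = insert i (noms f)"

primrec sub :: "form \<Rightarrow> form set" where
  "sub (Pro p) = {Pro p}"
| "sub (Nom i) = {Nom i}"
| "sub (Neg f) = insert (Neg f) (sub f)"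
| "sub (And f g) = insert (And f g) (sub f \<union> sub g)"
| "sub (Or f g) = insert (Or f g) (sub f \<union> sub g)"
| "sub (Dia f) = insert (Dia f) (sub f)"
| "sub (Box f) = insert (Box f) (sub f)"
| "sub (At i f) = insert (At i f) (sub f)"


section \<open>Semantics\<close>

record 'w model =
  worlds :: "'w set"
  acc :: "('w \<times> 'w) set"
  val :: "prp + nom \<Rightarrow> 'w set"

definition is_model :: "'w model \<Rightarrow> bool" where
  "is_model M \<longleftrightarrow>
     worlds M \<noteq> {} \<and>
     acc M \<subseteq> worlds M \<times> worlds M \<and>
     (\<forall>a. val M a \<subseteq> worlds M) \<and>
     (\<forall>i. is_singleton (val M (Inr i)))"

definition denot :: "'w model \<Rightarrow> nom \<Rightarrow> 'w" where
  "denot M i = the_elem (val M (Inr i))"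

primrec sat :: "'w model \<Rightarrow> 'w \<Rightarrow> form \<Rightarrow> bool" where
  "sat M w (Pro p) \<longleftrightarrow> w \<in> val M (Inl p)"
| "sat M w (Nom i) \<longleftrightarrow> w = denot M i"
| "sat M w (Neg f) \<longleftrightarrow> \<not> sat M w f"
| "sat M w (And f g) \<longleftrightarrow> sat M w f \<and> sat M w g"
| "sat M w (Or f g) \<longleftrightarrow> sat M w f \<or> sat M w g"
| "sat M w (Dia f) \<longleftrightarrow> (\<exists>v. (w, v) \<in> acc M \<and> sat M v f)"
| "sat M w (Box f) \<longleftrightarrow> (\<forall>v. (w, v) \<in> acc M \<longrightarrow> sat M v f)"
| "sat M w (At i f) \<longleftrightarrow> sat M (denot M i) f"

text \<open>HOL cannot quantify over all types inside a hypothesis, so validity in all TO models is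
  expressed as validity in all TO models whose worlds form a nonempty subset of \<open>UNIV :: 'w set\<close>,
  for an arbitrary infinite type \<open>'w\<close>. (For a finite \<open>'w\<close> only finite models would be covered,
  and the logic of all total orders does not have the finite model property.)\<close>

definition TO_model :: "'w model \<Rightarrow> bool" where
  "TO_model M \<longleftrightarrow> is_model M \<and> linear_order_on (worlds M) (acc M)"


section \<open>Branches\<close>

text \<open>A finite stage of a branch: the root formula, the formulas on the branch, those among them
  that are accessibility formulas, and the record of the applications of \<open>[\<Diamond>]\<close>, where
  \<open>(f, j) \<in> introd \<Theta>\<close> means that the rule was applied to \<open>f\<close> and introduced the nominal \<open>j\<close>.\<close>

record branch =
  root_form :: form
  forms :: "form set"
  access :: "form set"
  introd :: "(form \<times> nom) set"

definition initial :: "form \<Rightarrow> branch" where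
  "initial f = \<lparr>root_form = f, forms = {f}, access = {}, introd = {}\<rparr>"

definition branch_noms :: "branch \<Rightarrow> nom set" where
  "branch_noms \<Theta> = (\<Union>f\<in>forms \<Theta>. noms f)"

definition closed_forms :: "form set \<Rightarrow> bool" where
  "closed_forms F \<longleftrightarrow> (\<exists>i f. At i f \<in> F \<and> At i (neg f) \<in> F)"

definition asym_form :: "nom \<Rightarrow> form" where
  "asym_form i = Box (Or (Nom i) (Box (Neg (Nom i))))"

definition prefixed_sub :: "form \<Rightarrow> form \<Rightarrow> bool" where
  "prefixed_sub F G \<longleftrightarrow> (\<exists>i f j g. F = At i f \<and> G = At j g \<and> f \<in> sub g)"

definition T1 :: "branch \<Rightarrow> nom \<Rightarrow> form set" where
  "T1 \<Theta> i = {f. At i f \<in> forms \<Theta> \<and> prefixed_sub (At i f) (root_form \<Theta>)}"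

definition T2 :: "branch \<Rightarrow> nom \<Rightarrow> form set" where
  "T2 \<Theta> i = {f. At i f \<in> forms \<Theta> \<and>
     (\<exists>j\<in>noms (root_form \<Theta>). prefixed_sub (At i f) (At j (asym_form j)))}"

definition twins :: "branch \<Rightarrow> nom \<Rightarrow> nom \<Rightarrow> bool" where
  "twins \<Theta> i j \<longleftrightarrow> i \<in> branch_noms \<Theta> \<and> j \<in> branch_noms \<Theta> \<and>
     T1 \<Theta> i \<union> T2 \<Theta> i = T1 \<Theta> j \<union> T2 \<Theta> j"

definition prec :: "branch \<Rightarrow> (nom \<times> nom) set" where
  "prec \<Theta> = {(i, j). \<exists>f. (At i (Dia f), j) \<in> introd \<Theta>}"

definition quasi_urfather :: "branch \<Rightarrow> nom \<Rightarrow> bool" where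
  "quasi_urfather \<Theta> i \<longleftrightarrow>
     \<not> (\<exists>j k. j \<noteq> k \<and> twins \<Theta> j k \<and> (j, i) \<in> (prec \<Theta>)\<^sup>* \<and> (k, i) \<in> (prec \<Theta>)\<^sup>*)"


section \<open>Rules and tableaus\<close>

definition add :: "branch \<Rightarrow> form set \<Rightarrow> branch" where
  "add \<Theta> F = \<Theta>\<lparr>forms := forms \<Theta> \<union> F\<rparr>"

definition add_access :: "branch \<Rightarrow> form \<Rightarrow> branch" where
  "add_access \<Theta> f = \<Theta>\<lparr>forms := insert f (forms \<Theta>), access := insert f (access \<Theta>)\<rparr>"

definition add_dia :: "branch \<Rightarrow> nom \<Rightarrow> form \<Rightarrow> nom \<Rightarrow> branch" where
  "add_dia \<Theta> i f j = \<Theta>\<lparr>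
     forms := forms \<Theta> \<union> {At i (Dia (Nom j)), At j f},
     access := insert (At i (Dia (Nom j))) (access \<Theta>),
     introd := insert (At i (Dia f), j) (introd \<Theta>)\<rparr>"

text \<open>The rules; the list contains the branches produced. Restriction \<open>(\<D>)\<close> is
  the last premise of \<open>Dia_rule\<close>.\<close>

inductive tab_rule :: "branch \<Rightarrow> branch list \<Rightarrow> bool" where
  Eq_rule: "i \<in> branch_noms \<Theta> \<Longrightarrow> tab_rule \<Theta> [add \<Theta> {At i (Nom i)}]"
| And_rule: "At i (And f g) \<in> forms \<Theta> \<Longrightarrow> tab_rule \<Theta> [add \<Theta> {At i f, At i g}]"
| Or_rule: "At i (Or f g) \<in> forms \<Theta> \<Longrightarrow> tab_rule \<Theta> [add \<Theta> {At i f}, add \<Theta> {At i g}]"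
| Dia_rule: "At i (Dia f) \<in> forms \<Theta> \<Longrightarrow> At i (Dia f) \<notin> access \<Theta> \<Longrightarrow>
    j \<notin> branch_noms \<Theta> \<Longrightarrow> At i (Dia f) \<notin> fst ` introd \<Theta> \<Longrightarrow> quasi_urfather \<Theta> i \<Longrightarrow>
    tab_rule \<Theta> [add_dia \<Theta> i f j]"
| Box_rule: "At i (Box f) \<in> forms \<Theta> \<Longrightarrow> At i (Dia (Nom j)) \<in> forms \<Theta> \<Longrightarrow>
    tab_rule \<Theta> [add \<Theta> {At j f}]"
| At_rule: "At i (At j f) \<in> forms \<Theta> \<Longrightarrow> tab_rule \<Theta> [add \<Theta> {At j f}]"
| Id_rule: "At i f \<in> forms \<Theta> \<Longrightarrow> At i f \<notin> access \<Theta> \<Longrightarrow> At i (Nom j) \<in> forms \<Theta> \<Longrightarrow>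
    tab_rule \<Theta> [add \<Theta> {At j f}]"
| Ref_rule: "i \<in> branch_noms \<Theta> \<Longrightarrow> tab_rule \<Theta> [add_access \<Theta> (At i (Dia (Nom i)))]"
| Asym_rule: "i \<in> branch_noms \<Theta> \<Longrightarrow> tab_rule \<Theta> [add \<Theta> {At i (asym_form i)}]"
| Trs_rule: "At i (Box f) \<in> forms \<Theta> \<Longrightarrow> At i (Dia (Nom j)) \<in> forms \<Theta> \<Longrightarrow>
    tab_rule \<Theta> [add \<Theta> {At j (Box f)}]"
| Tot_rule: "i \<in> branch_noms \<Theta> \<Longrightarrow> j \<in> branch_noms \<Theta> \<Longrightarrow>
    tab_rule \<Theta> [add_access \<Theta> (At i (Dia (Nom j))), add_access \<Theta> (At j (Dia (Nom i)))]"

text \<open>Closed branches are not extended, and every branch produced must gain a new formula.\<close>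

definition extends :: "branch \<Rightarrow> branch list \<Rightarrow> bool" where
  "extends \<Theta> \<Theta>s \<longleftrightarrow> tab_rule \<Theta> \<Theta>s \<and> \<not> closed_forms (forms \<Theta>) \<and>
     (\<forall>\<Theta>'\<in>set \<Theta>s. forms \<Theta> \<subset> forms \<Theta>')"

text \<open>Tableaus may have infinite branches, hence a codatatype. A node carries the branch
  from the root of the tableau down to that node.\<close>

codatatype tableau = Node (stage: branch) (children: "tableau list")

coinductive wf_tableau :: "tableau \<Rightarrow> bool" where
  leaf: "wf_tableau (Node \<Theta> [])"
| node: "extends \<Theta> (map stage ts) \<Longrightarrow> (\<And>t. t \<in> set ts \<Longrightarrow> wf_tableau t) \<Longrightarrow>
    wf_tableau (Node \<Theta> ts)"

definition is_tableau :: "form \<Rightarrow> tableau \<Rightarrow> bool" where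
  "is_tableau f t \<longleftrightarrow> wf_tableau t \<and> stage t = initial f"

text \<open>A maximal path through a tableau; a finite one is prolonged by repeating its leaf.\<close>

definition is_path :: "tableau \<Rightarrow> (nat \<Rightarrow> tableau) \<Rightarrow> bool" where
  "is_path t \<pi> \<longleftrightarrow> \<pi> 0 = t \<and>
     (\<forall>n. if children (\<pi> n) = [] then \<pi> (Suc n) = \<pi> n
          else \<pi> (Suc n) \<in> set (children (\<pi> n)))"

definition closed_tableau :: "tableau \<Rightarrow> bool" where
  "closed_tableau t \<longleftrightarrow> (\<forall>\<pi>. is_path t \<pi> \<longrightarrow> closed_forms (\<Union>n. forms (stage (\<pi> n))))"

definition provable :: "form \<Rightarrow> bool" where
  "provable f \<longleftrightarrow>
     (\<exists>i t. i \<notin> noms f \<and> is_tableau (At i (neg f)) t \<and> closed_tableau t)"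

end

theory Submission
  imports Defs "HOL-Library.Countable"
begin

text \<open>A fair strategy yields a tableau each of whose open branches is saturated in the limit; \<open>[\<Diamond>]\<close> is
  then applied at every prefix that is a quasi-urfather of the limit, because a prefix has finitely many
  ancestors and \<open>T\<close> takes finitely many values, so that quasi-urfathers are recognized from some stage
  on. Termination is not needed.

  On an open limit branch the quasi-urfathers are totally preordered once each of them also sees the
  quasi-urfather twins of its successors. Twins agree on the subformulas of the root, so boxes
  propagate along this preorder and diamonds are witnessed. It remains to make it antisymmetric. A
  cluster containing a nominal of the root collapses to one point, since twins also agree on the
  antisymmetry formulas of the root nominals. Any other cluster is unfolded into a sequence of type
  \<open>\<omega>\<close> that visits each of its elements infinitely often.\<close>

section \<open>Negation normal form and subformulas\<close>

lemma sat_nnf: "sat M w (nnf f) \<longleftrightarrow> sat M w f"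
  by (induction f arbitrary: w rule: nnf.induct) auto

lemma sat_neg: "sat M w (neg f) \<longleftrightarrow> \<not> sat M w f"
  by (simp add: neg_def sat_nnf)

definition is_nnf :: "form \<Rightarrow> bool" where
  "is_nnf f \<longleftrightarrow> (\<forall>g. Neg g \<in> sub f \<longrightarrow> (\<exists>p. g = Pro p) \<or> (\<exists>i. g = Nom i))"

lemma is_nnf_nnf: "is_nnf (nnf f)"
  unfolding is_nnf_def by (induction f rule: nnf.induct) auto

lemma sub_refl: "f \<in> sub f"
  by (cases f) auto

lemma sub_trans: "g \<in> sub f \<Longrightarrow> sub g \<subseteq> sub f"
  by (induction f) auto

lemma noms_sub: "g \<in> sub f \<Longrightarrow> noms g \<subseteq> noms f"
  by (induction f) auto

lemma finite_sub: "finite (sub f)"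
  by (induction f) auto

lemma finite_noms: "finite (noms f)"
  by (induction f) auto

text \<open>This is the finite set from which the sets \<open>T\<close> are drawn for a branch with
  root \<open>f\<close>; prefixes are stripped.\<close>

definition relevant :: "form \<Rightarrow> form set" where
  "relevant f = {g. \<exists>i h. f = At i h \<and> g \<in> sub h} \<union> (\<Union>j\<in>noms f. sub (asym_form j))"

lemma relevant_At: "relevant (At i f) = sub f \<union> (\<Union>j\<in>insert i (noms f). sub (asym_form j))"
  by (auto simp: relevant_def)

lemma finite_relevant: "finite (relevant (At i f))"
  by (simp add: relevant_At finite_sub finite_noms)

text \<open>Closure under subformulas lets a twin inherit the body of a box together with the
  box.\<close>

lemma sub_relevant:
  assumes "g \<in> relevant f" shows "sub g \<subseteq> relevant f"
proof -
  from assms consider i h where "f = At i h" "g \<in> sub h" | j where "j \<in> noms f" "g \<in> sub (asym_form j)"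
    unfolding relevant_def by blast
  then show ?thesis
    by cases (use sub_trans in \<open>fastforce simp: relevant_def\<close>)+
qed

text \<open>Being twins thus amounts to agreeing on \<open>relevant\<close> formulas, which is how
  twins appear from here on.\<close>

lemma T1_Un_T2: "T1 \<Theta> x \<union> T2 \<Theta> x = {f \<in> relevant (root_form \<Theta>). At x f \<in> forms \<Theta>}"
  by (auto simp: T1_def T2_def relevant_def prefixed_sub_def)


section \<open>Countermodels from saturated sets\<close>

text \<open>\<open>F\<close> is the set of formulas of a branch and \<open>W\<close> the set of its quasi-urfathers.\<close>

locale saturated =
  fixes F :: "form set" and W N :: "nom set" and i0 :: nom and \<phi>0 :: form
  assumes root: "At i0 \<phi>0 \<in> F"
    and nnf: "is_nnf \<phi>0"
    and open_forms: "\<not> closed_forms F"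
    and N_def: "N = (\<Union>f\<in>F. noms f)"
    and W_sub: "W \<subseteq> N"
    and root_W: "noms (At i0 \<phi>0) \<subseteq> W"
    and Eq_F: "i \<in> N \<Longrightarrow> At i (Nom i) \<in> F"
    and And_F: "At i (And f g) \<in> F \<Longrightarrow> At i f \<in> F \<and> At i g \<in> F"
    and Or_F: "At i (Or f g) \<in> F \<Longrightarrow> At i f \<in> F \<or> At i g \<in> F"
    and Dia_F: "At i (Dia f) \<in> F \<Longrightarrow> i \<in> W \<Longrightarrow> (\<And>j. f \<noteq> Nom j) \<Longrightarrow>
      \<exists>c\<in>N. \<exists>j\<in>W. At i (Dia (Nom c)) \<in> F \<and> At c f \<in> F \<and>
        (\<forall>g\<in>relevant (At i0 \<phi>0). At c g \<in> F \<longleftrightarrow> At j g \<in> F)"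
    and Box_F: "At i (Box f) \<in> F \<Longrightarrow> At i (Dia (Nom j)) \<in> F \<Longrightarrow> At j f \<in> F"
    and At_F: "At i (At j f) \<in> F \<Longrightarrow> At j f \<in> F"
    and Id_F: "At i f \<in> F \<Longrightarrow> At i (Nom j) \<in> F \<Longrightarrow> (\<And>k. f \<noteq> Dia (Nom k)) \<Longrightarrow> At j f \<in> F"
    and Ref_F: "i \<in> N \<Longrightarrow> At i (Dia (Nom i)) \<in> F"
    and Asym_F: "i \<in> N \<Longrightarrow> At i (asym_form i) \<in> F"
    and Trs_F: "At i (Box f) \<in> F \<Longrightarrow> At i (Dia (Nom j)) \<in> F \<Longrightarrow> At j (Box f) \<in> F"
    and Tot_F: "i \<in> N \<Longrightarrow> j \<in> N \<Longrightarrow> At i (Dia (Nom j)) \<in> F \<or> At j (Dia (Nom i)) \<in> F"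
begin

section \<open>The preorder on quasi-urfathers\<close>

abbreviation rel :: "form set" where
  "rel \<equiv> relevant (At i0 \<phi>0)"

abbreviation root_noms :: "nom set" where
  "root_noms \<equiv> noms (At i0 \<phi>0)"

text \<open>A world sees \<open>y\<close> as soon as the branch makes it see, or equal to, a twin of \<open>y\<close>. The equality
  disjunct is needed because \<open>[Id]\<close> does not copy accessibility formulas.\<close>

definition step :: "nom \<Rightarrow> nom \<Rightarrow> bool" where
  "step x y \<longleftrightarrow> x \<in> W \<and> y \<in> W \<and>
     (\<exists>c\<in>N. (At x (Dia (Nom c)) \<in> F \<or> At x (Nom c) \<in> F) \<and>
       (\<forall>g\<in>rel. At c g \<in> F \<longleftrightarrow> At y g \<in> F))"

abbreviation reach :: "nom \<Rightarrow> nom \<Rightarrow> bool" where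
  "reach \<equiv> step\<^sup>*\<^sup>*"

definition cluster :: "nom \<Rightarrow> nom \<Rightarrow> bool" where
  "cluster x y \<longleftrightarrow> reach x y \<and> reach y x"

lemma At_N: "At i f \<in> F \<Longrightarrow> i \<in> N"
  by (force simp: N_def)

lemma contradictory: "At i f \<in> F \<Longrightarrow> At i (neg f) \<in> F \<Longrightarrow> False"
  using open_forms by (auto simp: closed_forms_def)

lemma Nom_sym: "At x (Nom y) \<in> F \<Longrightarrow> At y (Nom x) \<in> F"
  using Id_F[of x "Nom x" y] Eq_F[OF At_N] by simp

lemma step_Dia: "x \<in> W \<Longrightarrow> y \<in> W \<Longrightarrow> At x (Dia (Nom y)) \<in> F \<Longrightarrow> step x y"
  using W_sub by (auto simp: step_def)

lemma step_Nom: "x \<in> W \<Longrightarrow> y \<in> W \<Longrightarrow> At x (Nom y) \<in> F \<Longrightarrow> step x y"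
  using W_sub by (auto simp: step_def)

lemma reach_total: "x \<in> W \<Longrightarrow> y \<in> W \<Longrightarrow> reach x y \<or> reach y x"
  using Tot_F step_Dia W_sub by blast

text \<open>\<open>[Trs]\<close> or \<open>[Id]\<close> carries the box to the intermediate nominal
  \<open>c\<close>, reflexivity of \<open>c\<close> yields its body, and both pass to the twin
  \<open>y\<close> because they are relevant.\<close>

lemma Box_step:
  assumes "step x y" "At x (Box f) \<in> F" "Box f \<in> rel"
  shows "At y (Box f) \<in> F \<and> At y f \<in> F"
proof -
  obtain c where c: "c \<in> N" "At x (Dia (Nom c)) \<in> F \<or> At x (Nom c) \<in> F"
    and twin: "\<forall>g\<in>rel. At c g \<in> F \<longleftrightarrow> At y g \<in> F"
    using assms(1) by (auto simp: step_def)
  have "At c (Box f) \<in> F"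
    using c(2) assms(2) Trs_F Id_F by blast
  moreover from this have "At c f \<in> F"
    using Box_F Ref_F c(1) by blast
  moreover have "f \<in> rel"
    using sub_relevant[OF assms(3)] sub_refl by auto
  ultimately show ?thesis
    using twin assms(3) by blast
qed

lemma Box_reach:
  assumes "reach x y" "At x (Box f) \<in> F" "Box f \<in> rel"
  shows "At y (Box f) \<in> F"
  using assms by (induction rule: rtranclp_induct) (auto dest: Box_step)

lemma reach_W: "reach x y \<Longrightarrow> x \<in> W \<Longrightarrow> y \<in> W"
  by (induction rule: rtranclp_induct) (auto simp: step_def)

text \<open>The box travels to \<open>y\<close>, where \<open>[Ref]\<close> and
  \<open>[\<Box>]\<close> unpack it; this also covers a path of length zero.\<close>

lemma Box_reach_body:
  assumes "reach x y" "At x (Box f) \<in> F" "Box f \<in> rel" "x \<in> W"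
  shows "At y f \<in> F"
  using Box_reach[OF assms(1-3)] reach_W[OF assms(1,4)] Box_F Ref_F W_sub by blast

text \<open>This is where the formulas \<open>T\<^sub>2\<close> enter the definition of twins.\<close>

lemma cluster_root_nom:
  assumes "i \<in> root_noms" "cluster x i"
  shows "At x (Nom i) \<in> F"
proof -
  have rel: "Box (Or (Nom i) (Box (Neg (Nom i)))) \<in> rel" "Box (Neg (Nom i)) \<in> rel"
    using assms(1) by (auto simp: relevant_def asym_form_def)
  have i: "i \<in> W" "i \<in> N"
    using assms(1) root_W W_sub by auto
  have r: "reach i x" "reach x i"
    using assms(2) by (auto simp: cluster_def)
  have "At i (Box (Or (Nom i) (Box (Neg (Nom i))))) \<in> F"
    using Asym_F[OF i(2)] by (simp add: asym_form_def)
  then have "At x (Or (Nom i) (Box (Neg (Nom i)))) \<in> F"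
    using Box_reach_body r rel i by blast
  \<comment> \<open>Otherwise the box would travel back to \<open>i\<close> and put the negation of
    \<open>i\<close> there, against \<open>[Eq]\<close>.\<close>
  moreover have "At x (Box (Neg (Nom i))) \<notin> F"
    using Box_reach_body[OF r(2) _ rel(2)] reach_W[OF r(1) i(1)] contradictory Eq_F[OF i(2)]
    by (force simp: neg_def)
  ultimately show ?thesis
    using Or_F by blast
qed

section \<open>Clusters and their points\<close>

lemma cluster_refl: "cluster x x"
  by (simp add: cluster_def)

lemma cluster_sym: "cluster x y \<Longrightarrow> cluster y x"
  by (simp add: cluster_def)

lemma cluster_trans: "cluster x y \<Longrightarrow> cluster y z \<Longrightarrow> cluster x z"
  by (auto simp: cluster_def)

lemma cluster_Nom: "x \<in> W \<Longrightarrow> y \<in> W \<Longrightarrow> At x (Nom y) \<in> F \<Longrightarrow> cluster x y"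
  using step_Nom Nom_sym by (auto simp: cluster_def)

definition nominal :: "nom \<Rightarrow> bool" where
  "nominal x \<longleftrightarrow> (\<exists>i\<in>root_noms. cluster x i)"

text \<open>Taking the least root nominal makes the choice depend on the cluster alone.\<close>

definition rep :: "nom \<Rightarrow> nom" where
  "rep x = (LEAST i. i \<in> root_noms \<and> cluster x i)"

lemma rep:
  assumes "nominal x" shows "rep x \<in> root_noms" "cluster x (rep x)"
proof -
  have "\<exists>i. i \<in> root_noms \<and> cluster x i"
    using assms by (auto simp only: nominal_def)
  from LeastI_ex[OF this] show "rep x \<in> root_noms" "cluster x (rep x)"
    by (simp_all only: rep_def)
qed

lemma cluster_nominal: "cluster x y \<Longrightarrow> nominal x \<longleftrightarrow> nominal y"
  unfolding nominal_def using cluster_sym cluster_trans by blast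

lemma cluster_rep: "cluster x y \<Longrightarrow> rep x = rep y"
  unfolding rep_def using cluster_sym cluster_trans by metis

text \<open>The total preorder \<open>reach\<close> is turned into a linear order: a cluster becomes a sequence in which
  each of its elements occurs infinitely often, except that the cluster of a root nominal, whose
  elements are all equal to that nominal on the branch, becomes a single point.\<close>

definition represents :: "nat \<times> nom \<Rightarrow> nom \<Rightarrow> bool" where
  "represents w x \<longleftrightarrow> x \<in> W \<and> (if nominal x then w = (0, rep x) else snd w = x)"

definition points :: "(nat \<times> nom) set" where
  "points = {w. represents w (snd w)}"

text \<open>Distinct clusters are compared by \<open>reach\<close>; points of one cluster are
  compared by their codes, which are natural numbers, so that a cluster is a single point or has
  type omega.\<close>

definition le :: "nat \<times> nom \<Rightarrow> nat \<times> nom \<Rightarrow> bool" where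
  "le v w \<longleftrightarrow> reach (snd v) (snd w) \<and>
     (reach (snd w) (snd v) \<longrightarrow> prod_encode v \<le> prod_encode w)"

text \<open>The value \<open>i0\<close> is a default: nominals outside the root do not occur in the
  formulas to be evaluated.\<close>

definition den :: "nom \<Rightarrow> nat \<times> nom" where
  "den i = (0, rep (if i \<in> root_noms then i else i0))"

lemma represents_cluster: "represents w x \<Longrightarrow> cluster x (snd w)"
  by (auto simp: represents_def cluster_refl rep split: if_splits)

lemma represents_point: "represents w x \<Longrightarrow> w \<in> points"
proof -
  assume w: "represents w x"
  have cl: "cluster x (snd w)"
    using w by (rule represents_cluster)
  have "x \<in> W"
    using w by (simp add: represents_def)
  then have "snd w \<in> W"
    using reach_W[of x "snd w"] cl by (simp add: cluster_def)
  then show "w \<in> points"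
    using w cl cluster_nominal[of x "snd w"] cluster_rep[of x "snd w"]
    by (cases w) (simp add: points_def represents_def split: if_splits)
qed

lemma root_nominal: "i \<in> root_noms \<Longrightarrow> nominal i"
  unfolding nominal_def using cluster_refl by blast

lemma represents_den: "i \<in> root_noms \<Longrightarrow> represents (den i) i"
  using root_nominal[of i] root_W unfolding represents_def den_def by auto

lemma den_point: "den i \<in> points"
  using represents_den[of i] represents_den[of i0] represents_point
  unfolding den_def by (cases "i \<in> root_noms") auto

lemma points_W: "w \<in> points \<Longrightarrow> snd w \<in> W"
  by (simp add: points_def represents_def)

text \<open>This gives diamonds their witnesses. Inside a cluster it relies on each element
  recurring arbitrarily late, or on the cluster being a single point.\<close>

lemma ex_point_above:
  assumes "represents w x" "reach x y"
  shows "\<exists>v. represents v y \<and> le w v"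
proof -
  have x: "x \<in> W" and y: "y \<in> W"
    using assms reach_W by (auto simp: represents_def)
  have wx: "cluster x (snd w)"
    using assms(1) by (rule represents_cluster)
  show ?thesis
  proof (cases "nominal y")
    case True
    then have v: "represents (0, rep y) y"
      using y by (simp add: represents_def)
    have yr: "cluster y (rep y)"
      using rep True by blast
    have "reach (snd w) (rep y)"
      using wx assms(2) yr by (auto simp: cluster_def)
    \<comment> \<open>If \<open>y\<close> lies in the cluster of \<open>w\<close>, then
      \<open>w\<close> is the only point of that cluster.\<close>
    moreover have "w = (0, rep y)" if "reach (rep y) (snd w)"
    proof -
      have "cluster x y"
        using that wx yr assms(2) by (auto simp: cluster_def)
      then show ?thesis
        using assms(1) True cluster_nominal cluster_rep by (auto simp: represents_def)
    qed
    ultimately show ?thesis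
      using v by (auto simp: le_def)
  next
    case False
    \<comment> \<open>The copy of \<open>y\<close> indexed by the code of \<open>w\<close> is late
      enough, since the code of a pair is at least its first component.\<close>
    have "represents (prod_encode w, y) y"
      using y False by (simp add: represents_def)
    moreover have "reach (snd w) y"
      using wx assms(2) by (auto simp: cluster_def)
    ultimately show ?thesis
      using le_prod_encode_1 by (auto simp: le_def)
  qed
qed

section \<open>The linear order and the countermodel\<close>

lemma le_refl: "le w w"
  by (simp add: le_def)

lemma le_trans: "le u v \<Longrightarrow> le v w \<Longrightarrow> le u w"
  unfolding le_def by (meson order_trans rtranclp_trans)

lemma le_antisym: "le v w \<Longrightarrow> le w v \<Longrightarrow> v = w"
  unfolding le_def by (meson injD inj_prod_encode order_antisym)

lemma le_total: "v \<in> points \<Longrightarrow> w \<in> points \<Longrightarrow> le v w \<or> le w v"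
  unfolding le_def using reach_total[of "snd v" "snd w"] points_W by (meson linear)

text \<open>The injection \<open>e\<close> transports the points into an arbitrary infinite type. A
  point may represent several nominals, hence the existential quantifier in the valuation.\<close>

definition countermodel :: "(nat \<times> nom \<Rightarrow> 'w) \<Rightarrow> 'w model" where
  "countermodel e = \<lparr>
     worlds = e ` points,
     acc = {(e v, e w) | v w. v \<in> points \<and> w \<in> points \<and> le v w},
     val = case_sum (\<lambda>p. {e w | w. \<exists>x. represents w x \<and> At x (Pro p) \<in> F}) (\<lambda>i. {e (den i)})\<rparr>"

lemma denot_countermodel: "denot (countermodel e) i = e (den i)"
  by (simp add: denot_def countermodel_def)

lemma val_countermodel_Inl:
  assumes "inj e"
  shows "e w \<in> val (countermodel e) (Inl p) \<longleftrightarrow> (\<exists>x. represents w x \<and> At x (Pro p) \<in> F)"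
  by (auto simp: countermodel_def inj_eq[OF assms] simp del: split_paired_Ex)

lemma acc_countermodel:
  assumes "inj e"
  shows "(e v, e w) \<in> acc (countermodel e) \<longleftrightarrow> v \<in> points \<and> w \<in> points \<and> le v w"
  by (auto simp: countermodel_def inj_eq[OF assms] simp del: split_paired_Ex)

lemma TO_model_countermodel:
  assumes "inj e" shows "TO_model (countermodel e)"
proof -
  have "is_model (countermodel e)"
    using den_point represents_point
    by (auto simp: is_model_def countermodel_def split: sum.split)
  moreover have "linear_order_on (e ` points) (acc (countermodel e))"
    unfolding linear_order_on_def partial_order_on_def preorder_on_def
  proof (intro conjI)
    note acc = acc_countermodel[OF assms]
    have sub: "acc (countermodel e) \<subseteq> e ` points \<times> e ` points"
      by (auto simp: countermodel_def)
    then show "acc (countermodel e) \<subseteq> e ` points \<times> e ` points" .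
    show "refl_on (e ` points) (acc (countermodel e))"
      by (auto simp: refl_on_def acc le_refl)
    show "trans (acc (countermodel e))"
    proof (rule transI)
      fix a b c assume *: "(a, b) \<in> acc (countermodel e)" "(b, c) \<in> acc (countermodel e)"
      then obtain u v w where "a = e u" "b = e v" "c = e w"
        using sub by blast
      then show "(a, c) \<in> acc (countermodel e)"
        using * acc le_trans by metis
    qed
    show "antisym (acc (countermodel e))"
    proof (rule antisymI)
      fix a b assume *: "(a, b) \<in> acc (countermodel e)" "(b, a) \<in> acc (countermodel e)"
      then obtain u v where "a = e u" "b = e v"
        using sub by blast
      then show "a = b"
        using * acc le_antisym by metis
    qed
    show "total_on (e ` points) (acc (countermodel e))"
      using le_total by (auto simp only: total_on_def acc ball_simps)
  qed
  ultimately show ?thesis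
    by (simp add: TO_model_def countermodel_def)
qed

text \<open>Only the point of a root nominal can represent several nominals, and all of them equal
  that root nominal on the branch. Hence identifying them creates no conflict between
  literals.\<close>

lemma represents_both_Nom:
  assumes "represents w x" "represents w y"
  shows "At x (Nom y) \<in> F"
proof -
  have xy: "x \<in> W" "y \<in> W" "x \<in> N" "y \<in> N"
    using assms W_sub by (auto simp: represents_def)
  have cl: "cluster x y"
    using assms represents_cluster cluster_sym cluster_trans by blast
  show ?thesis
  proof (cases "nominal x")
    case True
    then have "At x (Nom (rep x)) \<in> F" "At y (Nom (rep x)) \<in> F"
      using cluster_root_nom rep cl cluster_rep cluster_nominal by metis+
    then show ?thesis
      using Id_F Nom_sym by blast
  next
    case False
    then have "x = y"
      using assms cluster_nominal[OF cl] by (simp add: represents_def)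
    then show ?thesis
      using Eq_F xy by blast
  qed
qed

text \<open>Subformulas of the root are relevant, so twins agree on them. The statement covers every
  nominal represented by the point, because the induction hypothesis is used at other
  representatives.\<close>

lemma truth:
  assumes "inj e"
  shows "f \<in> sub \<phi>0 \<Longrightarrow> At x f \<in> F \<Longrightarrow> represents w x \<Longrightarrow> sat (countermodel e) (e w) f"
proof (induction f arbitrary: x w)
  case (Pro p)
  then show ?case by (auto simp: val_countermodel_Inl[OF assms])
next
  case (Nom i)
  then have i: "i \<in> root_noms"
    using noms_sub by force
  then have "cluster x i"
    using Nom root_W cluster_Nom by (metis represents_def subsetD)
  moreover have "nominal i"
    using i by (rule root_nominal)
  ultimately have "w = den i"
    using Nom i cluster_nominal cluster_rep by (auto simp: represents_def den_def)
  then show ?case by (simp add: denot_countermodel)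
next
  case (Neg f)
  then consider p where "f = Pro p" | i where "f = Nom i"
    using nnf by (auto simp: is_nnf_def)
  then show ?case
  proof cases
    case (1 p)
    \<comment> \<open>The variable could be made true at \<open>w\<close> by another nominal
      \<open>y\<close>, but \<open>[Id]\<close> copies the negated variable from \<open>x\<close> to
      \<open>y\<close>.\<close>
    have False if "represents w y" "At y (Pro p) \<in> F" for y
    proof -
      have "At y (Neg (Pro p)) \<in> F"
        using Neg 1 that represents_both_Nom Id_F by blast
      then show False
        using that contradictory by (force simp: neg_def)
    qed
    then show ?thesis
      using 1 by (auto simp: val_countermodel_Inl[OF assms])
  next
    case (2 i)
    then have i: "i \<in> root_noms"
      using Neg.prems(1) noms_sub by force
    \<comment> \<open>Sharing a point with \<open>i\<close> puts \<open>x\<close> into the cluster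
      of a root nominal, where it equals \<open>i\<close> on the branch.\<close>
    have False if "w = den i"
    proof -
      have "cluster x i"
        using that Neg.prems(3) represents_den[OF i] represents_cluster cluster_sym cluster_trans
        by blast
      then have "At x (Nom i) \<in> F"
        using cluster_root_nom i by blast
      then show False
        using 2 Neg.prems(2) contradictory by (force simp: neg_def)
    qed
    then show ?thesis
      using 2 by (auto simp: denot_countermodel inj_eq[OF assms])
  qed
next
  case (And f g)
  have "f \<in> sub \<phi>0" "g \<in> sub \<phi>0"
    using sub_trans[OF And.prems(1)] sub_refl by auto
  then show ?case
    using And.IH And_F[OF And.prems(2)] And.prems(3) unfolding sat.simps by blast
next
  case (Or f g)
  have "f \<in> sub \<phi>0" "g \<in> sub \<phi>0"
    using sub_trans[OF Or.prems(1)] sub_refl by auto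
  then show ?case
    using Or.IH Or_F[OF Or.prems(2)] Or.prems(3) unfolding sat.simps by blast
next
  case (Dia f)
  have f: "f \<in> sub \<phi>0"
    using sub_trans[OF Dia.prems(1)] sub_refl by auto
  have x: "x \<in> W"
    using Dia.prems by (simp add: represents_def)
  have "\<exists>j. step x j \<and> (At j f \<in> F)"
  \<comment> \<open>A diamond over a nominal may be an accessibility formula, for which
    \<open>Dia_F\<close> gives nothing. Here the nominal comes from the root, so it is itself the
    witness.\<close>
  proof (cases "\<exists>i. f = Nom i")
    case True
    then obtain i where i: "f = Nom i" by blast
    then have "i \<in> W"
      using noms_sub[OF f] root_W by auto
    then show ?thesis
      using i step_Dia x Dia.prems Eq_F W_sub by blast
  next
    case False
    then obtain c j where c: "c \<in> N" "j \<in> W" "At x (Dia (Nom c)) \<in> F" "At c f \<in> F"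
      "\<forall>g\<in>rel. At c g \<in> F \<longleftrightarrow> At j g \<in> F"
      using Dia_F[OF Dia.prems(2) x] by blast
    moreover have "f \<in> rel"
      using f by (simp add: relevant_At)
    ultimately show ?thesis
      using x by (auto simp: step_def)
  qed
  then obtain j v where "At j f \<in> F" "represents v j" "le w v"
    using ex_point_above[OF Dia.prems(3)] by blast
  moreover from this have "sat (countermodel e) (e v) f"
    using Dia.IH f by blast
  moreover have "(e w, e v) \<in> acc (countermodel e)"
    using calculation Dia.prems represents_point by (simp add: acc_countermodel[OF assms])
  ultimately show ?case by auto
next
  case (Box f)
  have f: "f \<in> sub \<phi>0"
    using sub_trans[OF Box.prems(1)] sub_refl by auto
  have "sat (countermodel e) (e v) f" if v: "v \<in> points" "le w v" for v
  proof -
    \<comment> \<open>The point \<open>v\<close> represents \<open>snd v\<close>, so it suffices to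
      carry the box from \<open>x\<close> to that nominal.\<close>
    have "reach x (snd v)"
      using represents_cluster[OF Box.prems(3)] v(2) by (auto simp: cluster_def le_def)
    then have "At (snd v) f \<in> F"
      using Box_reach_body Box.prems by (auto simp: represents_def relevant_At)
    then show ?thesis
      using Box.IH f v(1) by (auto simp: points_def)
  qed
  moreover have "\<exists>v\<in>points. u = e v \<and> le w v" if u: "(e w, u) \<in> acc (countermodel e)" for u
  proof -
    obtain v where "u = e v"
      using u by (auto simp: countermodel_def)
    then show ?thesis
      using u acc_countermodel[OF assms] by blast
  qed
  ultimately show ?case
    unfolding sat.simps by blast
next
  case (At i f)
  have "i \<in> root_noms" "f \<in> sub \<phi>0"
    using noms_sub[OF At.prems(1)] sub_trans[OF At.prems(1)] sub_refl by auto
  then show ?case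
    using At.IH At_F[OF At.prems(2)] represents_den unfolding sat.simps denot_countermodel by blast
qed

lemma ex_countermodel:
  assumes "infinite (UNIV :: 'w set)"
  shows "\<exists>(M :: 'w model) w. TO_model M \<and> w \<in> worlds M \<and> sat M w \<phi>0"
proof -
  obtain h :: "nat \<Rightarrow> 'w" where "inj h"
    using infinite_countable_subset[OF assms] by auto
  then have e: "inj (h \<circ> prod_encode)"
    by (simp add: inj_compose inj_prod_encode)
  have "sat (countermodel (h \<circ> prod_encode)) ((h \<circ> prod_encode) (den i0)) \<phi>0"
    by (rule truth[OF e sub_refl root]) (simp add: represents_den)
  moreover have "(h \<circ> prod_encode) (den i0) \<in> worlds (countermodel (h \<circ> prod_encode))"
    using den_point by (simp add: countermodel_def)
  ultimately show ?thesis
    using TO_model_countermodel[OF e] by blast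
qed

end


section \<open>A fair strategy\<close>

instance form :: countable
  by countable_datatype

text \<open>A task fixes a rule and its premises but not the new nominal of
  \<open>[\<Diamond>]\<close>, which is computed from the stage.\<close>

datatype task =
    Eq_task nom
  | And_task nom form form
  | Or_task nom form form
  | Dia_task nom form
  | Box_task nom form nom
  | At_task nom nom form
  | Id_task nom form nom
  | Ref_task nom
  | Asym_task nom
  | Trs_task nom form nom
  | Tot_task nom nom

instance task :: countable
  by countable_datatype

definition fresh :: "branch \<Rightarrow> nom" where
  "fresh \<Theta> = (LEAST j. j \<notin> branch_noms \<Theta>)"

text \<open>The empty list signals that the premises of the task are not met.\<close>

primrec outcome :: "task \<Rightarrow> branch \<Rightarrow> branch list" where
  "outcome (Eq_task i) \<Theta> = (if i \<in> branch_noms \<Theta> then [add \<Theta> {At i (Nom i)}] else [])"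
| "outcome (And_task i f g) \<Theta> =
    (if At i (And f g) \<in> forms \<Theta> then [add \<Theta> {At i f, At i g}] else [])"
| "outcome (Or_task i f g) \<Theta> =
    (if At i (Or f g) \<in> forms \<Theta> then [add \<Theta> {At i f}, add \<Theta> {At i g}] else [])"
| "outcome (Dia_task i f) \<Theta> =
    (if At i (Dia f) \<in> forms \<Theta> \<and> At i (Dia f) \<notin> access \<Theta> \<and> At i (Dia f) \<notin> fst ` introd \<Theta> \<and>
        quasi_urfather \<Theta> i
     then [add_dia \<Theta> i f (fresh \<Theta>)] else [])"
| "outcome (Box_task i f j) \<Theta> =
    (if At i (Box f) \<in> forms \<Theta> \<and> At i (Dia (Nom j)) \<in> forms \<Theta> then [add \<Theta> {At j f}] else [])"
| "outcome (At_task i j f) \<Theta> = (if At i (At j f) \<in> forms \<Theta> then [add \<Theta> {At j f}] else [])"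
| "outcome (Id_task i f j) \<Theta> =
    (if At i f \<in> forms \<Theta> \<and> At i f \<notin> access \<Theta> \<and> At i (Nom j) \<in> forms \<Theta>
     then [add \<Theta> {At j f}] else [])"
| "outcome (Ref_task i) \<Theta> =
    (if i \<in> branch_noms \<Theta> then [add_access \<Theta> (At i (Dia (Nom i)))] else [])"
| "outcome (Asym_task i) \<Theta> =
    (if i \<in> branch_noms \<Theta> then [add \<Theta> {At i (asym_form i)}] else [])"
| "outcome (Trs_task i f j) \<Theta> =
    (if At i (Box f) \<in> forms \<Theta> \<and> At i (Dia (Nom j)) \<in> forms \<Theta> then [add \<Theta> {At j (Box f)}] else [])"
| "outcome (Tot_task i j) \<Theta> =
    (if i \<in> branch_noms \<Theta> \<and> j \<in> branch_noms \<Theta>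
     then [add_access \<Theta> (At i (Dia (Nom j))), add_access \<Theta> (At j (Dia (Nom i)))] else [])"

definition applicable :: "task \<Rightarrow> branch \<Rightarrow> bool" where
  "applicable t \<Theta> \<longleftrightarrow> outcome t \<Theta> \<noteq> [] \<and> extends \<Theta> (outcome t \<Theta>)"

definition chosen :: "branch \<Rightarrow> task" where
  "chosen \<Theta> = (ARG_MIN to_nat t. applicable t \<Theta>)"

definition successors :: "branch \<Rightarrow> branch list" where
  "successors \<Theta> = (if \<exists>t. applicable t \<Theta> then outcome (chosen \<Theta>) \<Theta> else [])"

lemma applicable_chosen: "applicable t \<Theta> \<Longrightarrow> applicable (chosen \<Theta>) \<Theta>"
  unfolding chosen_def by (rule arg_min_natI)

lemma chosen_le: "applicable t \<Theta> \<Longrightarrow> to_nat (chosen \<Theta>) \<le> to_nat t"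
  unfolding chosen_def by (rule arg_min_nat_le)

lemma extends_successors: "successors \<Theta> \<noteq> [] \<Longrightarrow> extends \<Theta> (successors \<Theta>)"
  using applicable_chosen by (auto simp: successors_def applicable_def split: if_splits)

lemma tab_rule_outcome:
  assumes "outcome t \<Theta> \<noteq> []" "finite (branch_noms \<Theta>)"
  shows "tab_rule \<Theta> (outcome t \<Theta>)"
proof -
  have "fresh \<Theta> \<notin> branch_noms \<Theta>"
    unfolding fresh_def using ex_new_if_finite[OF infinite_UNIV_nat assms(2)] by (rule LeastI_ex)
  then show ?thesis
    using assms(1) by (cases t) (auto split: if_splits intro: tab_rule.intros)
qed

lemma outcome_mono: "\<Theta>' \<in> set (outcome t \<Theta>) \<Longrightarrow> forms \<Theta> \<subseteq> forms \<Theta>'"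
  by (cases t) (auto simp: add_def add_access_def add_dia_def split: if_splits)

text \<open>The conclusions added on the branch taken persist, so that a repetition would produce a
  branch without a new formula. For \<open>[\<Diamond>]\<close>, whose nominal would differ, the
  record in \<open>introd\<close> blocks the repetition.\<close>

lemma not_applicable_again:
  assumes "\<Theta>' \<in> set (outcome t \<Theta>)" "forms \<Theta>' \<subseteq> forms \<Theta>''" "introd \<Theta>' \<subseteq> introd \<Theta>''"
  shows "\<not> applicable t \<Theta>''"
  using assms
  by (cases t) (force simp: applicable_def extends_def add_def add_access_def add_dia_def
      split: if_splits)+

section \<open>The tableau generated by the strategy\<close>

primcorec build :: "branch \<Rightarrow> tableau" where
  "stage (build \<Theta>) = \<Theta>"
| "children (build \<Theta>) = map build (successors \<Theta>)"

lemma wf_build: "wf_tableau (build \<Theta>)"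
proof -
  have "\<exists>\<Theta>. t = build \<Theta> \<Longrightarrow> wf_tableau t" for t
  proof (coinduction arbitrary: t)
    case wf_tableau
    then obtain \<Theta> where t: "t = build \<Theta>" by blast
    have n: "t = Node \<Theta> (map build (successors \<Theta>))"
      unfolding t by (rule build.code)
    have st: "map stage (map build (successors \<Theta>)) = successors \<Theta>"
      by (simp add: comp_def)
    show ?case
    proof (cases "successors \<Theta> = []")
      case True
      then show ?thesis using n by auto
    next
      case False
      have "extends \<Theta> (map stage (map build (successors \<Theta>)))"
        unfolding st using False by (rule extends_successors)
      then show ?thesis using n by auto
    qed
  qed
  then show ?thesis by blast
qed


section \<open>Open branches of the fair tableau\<close>

locale fair_branch =
  fixes \<Theta> :: "nat \<Rightarrow> branch" and i0 :: nom and \<phi>0 :: form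
  assumes zero: "\<Theta> 0 = initial (At i0 \<phi>0)"
    and Suc: "if successors (\<Theta> n) = [] then \<Theta> (Suc n) = \<Theta> n
      else \<Theta> (Suc n) \<in> set (successors (\<Theta> n))"
    and open_limit: "\<not> closed_forms (\<Union>n. forms (\<Theta> n))"
begin

section \<open>Invariants of the stages\<close>

lemma Suc_cases:
  obtains "successors (\<Theta> n) = []" "\<Theta> (Suc n) = \<Theta> n"
  | "successors (\<Theta> n) \<noteq> []" "\<Theta> (Suc n) \<in> set (successors (\<Theta> n))" "tab_rule (\<Theta> n) (successors (\<Theta> n))"
  using Suc[of n] extends_successors[of "\<Theta> n"] by (cases "successors (\<Theta> n) = []") (auto simp: extends_def)

lemma Suc_mono:
  "forms (\<Theta> n) \<subseteq> forms (\<Theta> (Suc n))"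
  "introd (\<Theta> n) \<subseteq> introd (\<Theta> (Suc n))"
  "root_form (\<Theta> (Suc n)) = root_form (\<Theta> n)"
  by (cases n rule: Suc_cases;
      force elim!: tab_rule.cases simp: add_def add_access_def add_dia_def)+

lemma forms_mono: "m \<le> n \<Longrightarrow> forms (\<Theta> m) \<subseteq> forms (\<Theta> n)"
  by (rule lift_Suc_mono_le[of "\<lambda>n. forms (\<Theta> n)"]) (rule Suc_mono)

lemma introd_mono: "m \<le> n \<Longrightarrow> introd (\<Theta> m) \<subseteq> introd (\<Theta> n)"
  by (rule lift_Suc_mono_le[of "\<lambda>n. introd (\<Theta> n)"]) (rule Suc_mono)

lemma branch_noms_mono: "m \<le> n \<Longrightarrow> branch_noms (\<Theta> m) \<subseteq> branch_noms (\<Theta> n)"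
  using forms_mono by (fastforce simp: branch_noms_def)

lemma root_form: "root_form (\<Theta> n) = At i0 \<phi>0"
  by (induction n) (simp_all add: zero initial_def Suc_mono)

lemma finite_branch_noms: "finite (branch_noms (\<Theta> n))"
proof -
  have "finite (forms (\<Theta> n))"
  proof (induction n)
    case (Suc n)
    then show ?case
      by (cases n rule: Suc_cases)
        (auto elim!: tab_rule.cases simp: add_def add_access_def add_dia_def)
  qed (simp add: zero initial_def)
  then show ?thesis
    by (simp add: branch_noms_def finite_noms)
qed

text \<open>Formulas of any other shape are therefore never exempt from \<open>[\<Diamond>]\<close>
  and \<open>[Id]\<close>; the assumptions of \<open>saturated\<close> exclude this shape rather
  than tracking the accessibility formulas.\<close>

lemma access_shape: "f \<in> access (\<Theta> n) \<Longrightarrow> \<exists>i j. f = At i (Dia (Nom j))"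
proof (induction n)
  case (Suc n)
  then show ?case
    by (cases n rule: Suc_cases)
      (auto elim!: tab_rule.cases simp: add_def add_access_def add_dia_def)
qed (simp add: zero initial_def)

lemma introd_Suc:
  assumes "(g, j) \<in> introd (\<Theta> (Suc n))" "(g, j) \<notin> introd (\<Theta> n)"
  shows "j \<notin> branch_noms (\<Theta> n)" "introd (\<Theta> (Suc n)) = insert (g, j) (introd (\<Theta> n))"
    "\<exists>i f. g = At i (Dia f) \<and> At i (Dia (Nom j)) \<in> forms (\<Theta> (Suc n)) \<and> At j f \<in> forms (\<Theta> (Suc n))"
  using assms
  by (cases n rule: Suc_cases;
      force elim!: tab_rule.cases simp: add_def add_access_def add_dia_def)+

lemma introd_shape: "(g, j) \<in> introd (\<Theta> n) \<Longrightarrow> \<exists>i f. g = At i (Dia f)"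
proof (induction n)
  case (Suc n)
  then show ?case
    using introd_Suc(3)[OF Suc.prems] by blast
qed (simp add: zero initial_def)

lemma introd_forms:
  "(At i (Dia f), j) \<in> introd (\<Theta> n) \<Longrightarrow>
    At i (Dia (Nom j)) \<in> forms (\<Theta> n) \<and> At j f \<in> forms (\<Theta> n)"
proof (induction n)
  case (Suc n)
  then show ?case
    using introd_Suc(3)[OF Suc.prems] Suc_mono(1)[of n]
    by (cases "(At i (Dia f), j) \<in> introd (\<Theta> n)") auto
qed (simp add: zero initial_def)

section \<open>The ancestry forest\<close>

lemma prec_noms: "(i, j) \<in> prec (\<Theta> n) \<Longrightarrow> i \<in> branch_noms (\<Theta> n) \<and> j \<in> branch_noms (\<Theta> n)"
  unfolding prec_def branch_noms_def using introd_forms by force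

lemma prec_Suc: "(i, j) \<in> prec (\<Theta> (Suc n)) \<Longrightarrow> j \<in> branch_noms (\<Theta> n) \<Longrightarrow> (i, j) \<in> prec (\<Theta> n)"
  unfolding prec_def using introd_Suc(1) by blast

text \<open>Since \<open>[\<Diamond>]\<close> introduces only nominals new to the stage, no edge
  into an old nominal is ever added.\<close>

lemma prec_earlier:
  assumes "m \<le> n" "(i, j) \<in> prec (\<Theta> n)" "j \<in> branch_noms (\<Theta> m)"
  shows "(i, j) \<in> prec (\<Theta> m)"
  using assms
proof (induction n rule: dec_induct)
  case (step n)
  then show ?case
    using prec_Suc branch_noms_mono[of m n] by blast
qed

lemma prec_parent_unique: "(i, k) \<in> prec (\<Theta> n) \<Longrightarrow> (j, k) \<in> prec (\<Theta> n) \<Longrightarrow> i = j"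
proof (induction n)
  case 0
  then show ?case by (simp add: prec_def zero initial_def)
next
  case (Suc n)
  show ?case
  proof (cases "k \<in> branch_noms (\<Theta> n)")
    case True
    then show ?thesis
      using Suc prec_Suc by blast
  next
    case False
    have old: "(g, k) \<notin> introd (\<Theta> n)" if "(g, k) \<in> introd (\<Theta> (Suc n))" for g
    proof
      assume "(g, k) \<in> introd (\<Theta> n)"
      moreover from this obtain i f where "g = At i (Dia f)"
        using introd_shape by blast
      ultimately have "(i, k) \<in> prec (\<Theta> n)"
        by (auto simp: prec_def)
      then show False
        using False prec_noms by blast
    qed
    obtain f g where "(At i (Dia f), k) \<in> introd (\<Theta> (Suc n))" "(At j (Dia g), k) \<in> introd (\<Theta> (Suc n))"
      using Suc.prems by (auto simp: prec_def)
    then show ?thesis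
      using introd_Suc(2) old by blast
  qed
qed

text \<open>A closed stage would close the limit, so closure never stops the strategy on this
  branch.\<close>

lemma not_closed: "\<not> closed_forms (forms (\<Theta> n))"
  using open_limit unfolding closed_forms_def by blast

lemma chosen_not_applicable_later:
  assumes "applicable t (\<Theta> m)" "m < n"
  shows "\<not> applicable (chosen (\<Theta> m)) (\<Theta> n)"
proof -
  have "successors (\<Theta> m) = outcome (chosen (\<Theta> m)) (\<Theta> m)"
    using assms(1) by (auto simp: successors_def)
  then have "\<Theta> (Suc m) \<in> set (outcome (chosen (\<Theta> m)) (\<Theta> m))"
    using Suc[of m] applicable_chosen[OF assms(1)] by (auto simp: applicable_def)
  then show ?thesis
    using not_applicable_again forms_mono introd_mono assms(2) by (metis Suc_leI)
qed

text \<open>A performed task never becomes applicable again, so choosing the task of least code is fair: only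
  finitely many tasks can take precedence over a given one.\<close>

lemma fair: "\<exists>n\<ge>m. \<not> applicable t (\<Theta> n)"
proof (rule ccontr)
  assume "\<not> ?thesis"
  then have app: "applicable t (\<Theta> n)" if "n \<ge> m" for n
    using that by blast
  \<comment> \<open>The tasks chosen from stage \<open>m\<close> on are pairwise distinct, yet their
    codes are bounded by that of \<open>t\<close>.\<close>
  have "inj_on (\<lambda>n. to_nat (chosen (\<Theta> n))) {m..}"
  proof (rule linorder_inj_onI')
    fix a b assume "a \<in> {m..}" "b \<in> {m..}" "a < b"
    then show "to_nat (chosen (\<Theta> a)) \<noteq> to_nat (chosen (\<Theta> b))"
      using chosen_not_applicable_later[OF app, of a b] applicable_chosen[OF app, of b] by auto
  qed
  moreover have "(\<lambda>n. to_nat (chosen (\<Theta> n))) ` {m..} \<subseteq> {..to_nat t}"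
    using chosen_le[OF app] by auto
  ultimately have "finite {m..}"
    using finite_imageD finite_subset by blast
  then show False
    using infinite_Ici by blast
qed

text \<open>By fairness the task is not applicable at some late stage. Its premises hold there and
  the branch is open, so the only obstacle is a produced branch that gains nothing.\<close>

lemma saturation:
  assumes "\<And>n. n \<ge> m \<Longrightarrow> outcome t (\<Theta> n) \<noteq> []"
  shows "\<exists>n\<ge>m. \<exists>\<Theta>'\<in>set (outcome t (\<Theta> n)). forms \<Theta>' \<subseteq> forms (\<Theta> n)"
proof -
  obtain n where n: "n \<ge> m" "\<not> applicable t (\<Theta> n)"
    using fair by blast
  then obtain \<Theta>' where "\<Theta>' \<in> set (outcome t (\<Theta> n))" "\<not> forms (\<Theta> n) \<subset> forms \<Theta>'"
    using assms tab_rule_outcome finite_branch_noms not_closed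
    unfolding applicable_def extends_def by blast
  moreover from this have "forms \<Theta>' \<subseteq> forms (\<Theta> n)"
    using outcome_mono by blast
  ultimately show ?thesis
    using n(1) by blast
qed

section \<open>The limit branch\<close>

definition limit :: branch where
  "limit = \<lparr>root_form = At i0 \<phi>0, forms = (\<Union>n. forms (\<Theta> n)), access = (\<Union>n. access (\<Theta> n)),
     introd = (\<Union>n. introd (\<Theta> n))\<rparr>"

lemma limit_forms: "f \<in> forms limit \<longleftrightarrow> (\<exists>m. \<forall>n\<ge>m. f \<in> forms (\<Theta> n))"
proof
  assume "f \<in> forms limit"
  then obtain m where "f \<in> forms (\<Theta> m)"
    by (auto simp: limit_def)
  then show "\<exists>m. \<forall>n\<ge>m. f \<in> forms (\<Theta> n)"
    using forms_mono by blast
qed (auto simp: limit_def)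

lemma limit_formsI: "f \<in> forms (\<Theta> n) \<Longrightarrow> f \<in> forms limit"
  by (auto simp: limit_def)

lemma limit_formsE:
  assumes "f \<in> forms limit" obtains m where "\<And>n. n \<ge> m \<Longrightarrow> f \<in> forms (\<Theta> n)"
  using assms limit_forms by blast

lemma limit_formsE2:
  assumes "f \<in> forms limit" "g \<in> forms limit"
  obtains m where "\<And>n. n \<ge> m \<Longrightarrow> f \<in> forms (\<Theta> n) \<and> g \<in> forms (\<Theta> n)"
proof -
  obtain k l where "\<And>n. n \<ge> k \<Longrightarrow> f \<in> forms (\<Theta> n)" "\<And>n. n \<ge> l \<Longrightarrow> g \<in> forms (\<Theta> n)"
    using assms limit_forms by meson
  then show ?thesis
    using that[of "max k l"] by simp
qed

lemma limit_nomsE: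
  assumes "i \<in> branch_noms limit" obtains m where "\<And>n. n \<ge> m \<Longrightarrow> i \<in> branch_noms (\<Theta> n)"
proof -
  obtain f where f: "f \<in> forms limit" "i \<in> noms f"
    using assms by (auto simp: branch_noms_def)
  then obtain m where "\<And>n. n \<ge> m \<Longrightarrow> f \<in> forms (\<Theta> n)"
    using limit_formsE by blast
  then show ?thesis
    using that[of m] f(2) by (auto simp: branch_noms_def)
qed

lemma branch_noms_limit: "branch_noms (\<Theta> n) \<subseteq> branch_noms limit"
  by (auto simp: branch_noms_def limit_def)

lemma prec_limit: "prec limit = (\<Union>n. prec (\<Theta> n))"
  by (auto simp: prec_def limit_def)

lemma prec_limit_parent:
  assumes "(i, k) \<in> prec limit" "(j, k) \<in> prec limit" shows "i = j"
proof -
  have *: "prec (\<Theta> a) \<subseteq> prec (\<Theta> (max a b))" "prec (\<Theta> b) \<subseteq> prec (\<Theta> (max a b))" for a b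
    using introd_mono[of a "max a b"] introd_mono[of b "max a b"] by (auto simp: prec_def)
  show ?thesis
    using assms * prec_parent_unique unfolding prec_limit by blast
qed

text \<open>Consequently a nominal has only finitely many ancestors in the limit: all occur in any
  finite stage that contains it.\<close>

lemma ancestor_earlier:
  assumes "(i, j) \<in> (prec limit)\<^sup>*" "j \<in> branch_noms (\<Theta> m)"
  shows "i \<in> branch_noms (\<Theta> m)"
  using assms
proof (induction rule: converse_rtrancl_induct)
  case (step i k)
  then have k: "k \<in> branch_noms (\<Theta> m)" by blast
  obtain n where n: "(i, k) \<in> prec (\<Theta> n)"
    using step by (auto simp: prec_limit)
  have "(i, k) \<in> prec (\<Theta> m)"
  proof (cases "m \<le> n")
    case True
    then show ?thesis using prec_earlier n k by blast
  next
    case False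
    then show ?thesis using n introd_mono[of n m] by (auto simp: prec_def)
  qed
  then show ?case
    using prec_noms by blast
qed

text \<open>Only finitely many relevant formulas can ever be prefixed by a nominal in
  \<open>X\<close>. Once all those of the limit have appeared, the sets \<open>T\<close> on
  \<open>X\<close> are final.\<close>

lemma twins_stabilize:
  assumes "finite X" "X \<subseteq> branch_noms limit"
  shows "\<exists>m. \<forall>n\<ge>m. \<forall>j\<in>X. \<forall>k\<in>X. twins (\<Theta> n) j k \<longrightarrow> twins limit j k"
proof -
  let ?A = "{(x, f). x \<in> X \<and> f \<in> relevant (At i0 \<phi>0) \<and> At x f \<in> forms limit}"
  have "?A \<subseteq> X \<times> relevant (At i0 \<phi>0)" by auto
  then have fin: "finite ?A"
    using finite_subset assms(1) finite_relevant by blast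
  have "\<forall>p\<in>?A. \<exists>m. \<forall>n\<ge>m. At (fst p) (snd p) \<in> forms (\<Theta> n)"
  proof
    fix p assume "p \<in> ?A"
    then have "At (fst p) (snd p) \<in> forms limit"
      by auto
    then show "\<exists>m. \<forall>n\<ge>m. At (fst p) (snd p) \<in> forms (\<Theta> n)"
      by (rule limit_forms[THEN iffD1])
  qed
  from bchoice[OF this] obtain M
    where M: "\<And>p n. p \<in> ?A \<Longrightarrow> n \<ge> M p \<Longrightarrow> At (fst p) (snd p) \<in> forms (\<Theta> n)"
    by blast
  \<comment> \<open>If \<open>?A\<close> is empty, this value is unspecified but harmless, as there
    is no formula to wait for.\<close>
  define m where "m = Max (M ` ?A)"
  have m: "M p \<le> m" if "p \<in> ?A" for p
    unfolding m_def using fin that by (intro Max_ge finite_imageI imageI)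
  have T: "T1 (\<Theta> n) x \<union> T2 (\<Theta> n) x = T1 limit x \<union> T2 limit x" if "n \<ge> m" "x \<in> X" for n x
    unfolding T1_Un_T2 root_form
  proof (rule Collect_cong, rule conj_cong)
    show "(f \<in> relevant (At i0 \<phi>0)) = (f \<in> relevant (root_form limit))" for f
      by (simp add: limit_def)
    show "(At x f \<in> forms (\<Theta> n)) = (At x f \<in> forms limit)"
      if "f \<in> relevant (root_form limit)" for f
    proof
      assume "At x f \<in> forms limit"
      then have "(x, f) \<in> ?A"
        using that \<open>x \<in> X\<close> by (simp add: limit_def)
      then show "At x f \<in> forms (\<Theta> n)"
        using M[of "(x, f)" n] m[of "(x, f)"] \<open>n \<ge> m\<close> by simp
    qed (rule limit_formsI)
  qed
  have "\<forall>n\<ge>m. \<forall>j\<in>X. \<forall>k\<in>X. twins (\<Theta> n) j k \<longrightarrow> twins limit j k"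
    using T assms(2) by (auto simp: twins_def)
  then show ?thesis by blast
qed

text \<open>Restriction \<open>(\<D>)\<close> is tested at finite stages. The ancestors being
  finitely many, any twins among them at a late stage would be twins in the limit.\<close>

lemma quasi_urfather_eventually:
  assumes "quasi_urfather limit i" "i \<in> branch_noms limit"
  shows "\<exists>m. \<forall>n\<ge>m. quasi_urfather (\<Theta> n) i"
proof -
  let ?X = "{j. (j, i) \<in> (prec limit)\<^sup>*}"
  obtain l where l: "i \<in> branch_noms (\<Theta> l)"
    using assms(2) limit_nomsE by blast
  have X: "?X \<subseteq> branch_noms (\<Theta> l)"
    using ancestor_earlier l by blast
  obtain m where m: "\<forall>n\<ge>m. \<forall>j\<in>?X. \<forall>k\<in>?X. twins (\<Theta> n) j k \<longrightarrow> twins limit j k"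
    using twins_stabilize[of ?X] X branch_noms_limit finite_branch_noms finite_subset by blast
  have "(prec (\<Theta> n))\<^sup>* \<subseteq> (prec limit)\<^sup>*" for n
    by (rule rtrancl_mono) (auto simp: prec_limit)
  then show ?thesis
    using m assms(1) unfolding quasi_urfather_def by blast
qed

lemma quasi_urfather_ancestor:
  "quasi_urfather limit i \<Longrightarrow> (j, i) \<in> (prec limit)\<^sup>* \<Longrightarrow> quasi_urfather limit j"
  unfolding quasi_urfather_def by (meson rtrancl_trans)

text \<open>If a child of a quasi-urfather is not one itself, it is a twin of one of its own ancestors,
  all of which are quasi-urfathers.\<close>

lemma child_twin:
  assumes "quasi_urfather limit i" "(i, c) \<in> prec limit"
  shows "\<exists>j. quasi_urfather limit j \<and> (j, c) \<in> (prec limit)\<^sup>* \<and>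
    T1 limit c \<union> T2 limit c = T1 limit j \<union> T2 limit j"
proof (cases "quasi_urfather limit c")
  case False
  then obtain j k where jk: "j \<noteq> k" "twins limit j k" "(j, c) \<in> (prec limit)\<^sup>*" "(k, c) \<in> (prec limit)\<^sup>*"
    by (auto simp: quasi_urfather_def)
  have above: "x = c \<or> (x, i) \<in> (prec limit)\<^sup>*" if "(x, c) \<in> (prec limit)\<^sup>*" for x
    using that prec_limit_parent[OF assms(2)] by (auto elim: rtranclE)
  have "j = c \<or> k = c"
    using jk above assms(1) by (auto simp: quasi_urfather_def)
  then show ?thesis
    using jk above quasi_urfather_ancestor[OF assms(1)] by (auto simp: twins_def)
qed auto

lemma limit_Dia:
  assumes "At i (Dia f) \<in> forms limit" "quasi_urfather limit i" "\<And>j. f \<noteq> Nom j"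
  shows "\<exists>c\<in>branch_noms limit. \<exists>j\<in>{j\<in>branch_noms limit. quasi_urfather limit j}.
    At i (Dia (Nom c)) \<in> forms limit \<and> At c f \<in> forms limit \<and>
    (\<forall>g\<in>relevant (At i0 \<phi>0). At c g \<in> forms limit \<longleftrightarrow> At j g \<in> forms limit)"
proof -
  have "i \<in> branch_noms limit"
    using assms(1) by (force simp: branch_noms_def)
  then obtain k where k: "\<And>n. n \<ge> k \<Longrightarrow> quasi_urfather (\<Theta> n) i"
    using quasi_urfather_eventually assms(2) by blast
  obtain l where l: "\<And>n. n \<ge> l \<Longrightarrow> At i (Dia f) \<in> forms (\<Theta> n)"
    using assms(1) limit_formsE by blast
  have nonaccess: "At i (Dia f) \<notin> access (\<Theta> n)" for n
    using access_shape assms(3) by blast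
  \<comment> \<open>If \<open>[\<Diamond>]\<close> were never applied to this formula, its task
    would stay enabled and saturation would place a fresh nominal on the branch already.\<close>
  have "\<exists>n c. (At i (Dia f), c) \<in> introd (\<Theta> n)"
  proof (rule ccontr)
    assume "\<not> ?thesis"
    then have "At i (Dia f) \<notin> fst ` introd (\<Theta> n)" for n
      by force
    then have out: "outcome (Dia_task i f) (\<Theta> n) = [add_dia (\<Theta> n) i f (fresh (\<Theta> n))]"
      if "n \<ge> max k l" for n
      using that k l nonaccess by simp
    then obtain n where "forms (add_dia (\<Theta> n) i f (fresh (\<Theta> n))) \<subseteq> forms (\<Theta> n)"
      using saturation[of "max k l" "Dia_task i f"] by fastforce
    then have "At i (Dia (Nom (fresh (\<Theta> n)))) \<in> forms (\<Theta> n)"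
      by (simp add: add_dia_def)
    then have "fresh (\<Theta> n) \<in> branch_noms (\<Theta> n)"
      by (force simp: branch_noms_def)
    moreover have "fresh (\<Theta> n) \<notin> branch_noms (\<Theta> n)"
      unfolding fresh_def using ex_new_if_finite[OF infinite_UNIV_nat finite_branch_noms]
      by (rule LeastI_ex)
    ultimately show False by contradiction
  qed
  then obtain n c where c: "(At i (Dia f), c) \<in> introd (\<Theta> n)" by blast
  then have forms: "At i (Dia (Nom c)) \<in> forms limit" "At c f \<in> forms limit"
    using introd_forms limit_formsI by blast+
  have prec: "(i, c) \<in> prec limit"
    using c unfolding prec_limit by (auto simp: prec_def)
  have c_nom: "c \<in> branch_noms (\<Theta> n)"
    using c prec_noms by (auto simp: prec_def)
  \<comment> \<open>The new nominal \<open>c\<close> need not be a quasi-urfather, so a twin of it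
    stands in as the world.\<close>
  obtain j where j: "quasi_urfather limit j" "(j, c) \<in> (prec limit)\<^sup>*"
    "T1 limit c \<union> T2 limit c = T1 limit j \<union> T2 limit j"
    using child_twin[OF assms(2) prec] by blast
  have "j \<in> branch_noms limit" "c \<in> branch_noms limit"
    using ancestor_earlier[OF j(2) c_nom] c_nom branch_noms_limit by blast+
  moreover have "\<forall>g\<in>relevant (At i0 \<phi>0). At c g \<in> forms limit \<longleftrightarrow> At j g \<in> forms limit"
    using j(3) unfolding T1_Un_T2 by (auto simp: limit_def)
  ultimately show ?thesis
    using forms j(1) by blast
qed

text \<open>Nominals of the root are never introduced by \<open>[\<Diamond>]\<close>, so each is its
  own only ancestor.\<close>

lemma root_quasi_urfather:
  assumes "i \<in> noms (At i0 \<phi>0)"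
  shows "i \<in> branch_noms limit" "quasi_urfather limit i"
proof -
  have i: "i \<in> branch_noms (\<Theta> 0)"
    using assms by (simp add: zero initial_def branch_noms_def)
  then show "i \<in> branch_noms limit"
    using branch_noms_limit by blast
  have "(j, i) \<notin> prec (\<Theta> n)" for j n
    using prec_earlier[of 0 n j i] i by (auto simp: prec_def zero initial_def)
  then have "(j, i) \<notin> prec limit" for j
    by (simp add: prec_limit)
  then have "j = i" if "(j, i) \<in> (prec limit)\<^sup>*" for j
    using that by (blast elim: rtranclE)
  then show "quasi_urfather limit i"
    unfolding quasi_urfather_def by blast
qed

text \<open>Premises in the limit are present from some stage on, which keeps the corresponding task
  enabled, so that \<open>saturation\<close> supplies the conclusions.\<close>

lemma saturated_limit:
  assumes "is_nnf \<phi>0"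
  shows "saturated (forms limit) {j \<in> branch_noms limit. quasi_urfather limit j}
    (branch_noms limit) i0 \<phi>0"
proof
  show "At i0 \<phi>0 \<in> forms limit"
    by (rule limit_formsI[of _ 0]) (simp add: zero initial_def)
  show "is_nnf \<phi>0" by fact
  show "\<not> closed_forms (forms limit)"
    using open_limit by (simp add: limit_def)
  show "branch_noms limit = (\<Union>f\<in>forms limit. noms f)"
    by (simp add: branch_noms_def)
  show "{j \<in> branch_noms limit. quasi_urfather limit j} \<subseteq> branch_noms limit"
    by blast
  show "noms (At i0 \<phi>0) \<subseteq> {j \<in> branch_noms limit. quasi_urfather limit j}"
    using root_quasi_urfather by blast
next
  fix i assume "i \<in> branch_noms limit"
  then obtain m where m: "\<And>n. n \<ge> m \<Longrightarrow> i \<in> branch_noms (\<Theta> n)"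
    using limit_nomsE by blast
  show "At i (Nom i) \<in> forms limit"
    using saturation[of m "Eq_task i"] m limit_formsI by (auto simp: add_def)
  show "At i (Dia (Nom i)) \<in> forms limit"
    using saturation[of m "Ref_task i"] m limit_formsI by (auto simp: add_access_def)
  show "At i (asym_form i) \<in> forms limit"
    using saturation[of m "Asym_task i"] m limit_formsI by (auto simp: add_def)
next
  fix i f g assume "At i (And f g) \<in> forms limit"
  then obtain m where m: "\<And>n. n \<ge> m \<Longrightarrow> At i (And f g) \<in> forms (\<Theta> n)"
    using limit_formsE by blast
  show "At i f \<in> forms limit \<and> At i g \<in> forms limit"
    using saturation[of m "And_task i f g"] m limit_formsI by (auto simp: add_def)
next
  fix i f g assume "At i (Or f g) \<in> forms limit"
  then obtain m where m: "\<And>n. n \<ge> m \<Longrightarrow> At i (Or f g) \<in> forms (\<Theta> n)"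
    using limit_formsE by blast
  show "At i f \<in> forms limit \<or> At i g \<in> forms limit"
    using saturation[of m "Or_task i f g"] m limit_formsI by (auto simp: add_def)
next
  fix i f assume "At i (Dia f) \<in> forms limit" "i \<in> {j \<in> branch_noms limit. quasi_urfather limit j}"
    "\<And>j. f \<noteq> Nom j"
  then show "\<exists>c\<in>branch_noms limit. \<exists>j\<in>{j \<in> branch_noms limit. quasi_urfather limit j}.
    At i (Dia (Nom c)) \<in> forms limit \<and> At c f \<in> forms limit \<and>
    (\<forall>g\<in>relevant (At i0 \<phi>0). At c g \<in> forms limit \<longleftrightarrow> At j g \<in> forms limit)"
    using limit_Dia by blast
next
  fix i f j assume "At i (Box f) \<in> forms limit" "At i (Dia (Nom j)) \<in> forms limit"
  then obtain m where m: "\<And>n. n \<ge> m \<Longrightarrow>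
    At i (Box f) \<in> forms (\<Theta> n) \<and> At i (Dia (Nom j)) \<in> forms (\<Theta> n)"
    using limit_formsE2 by blast
  show "At j f \<in> forms limit"
    using saturation[of m "Box_task i f j"] m limit_formsI by (auto simp: add_def)
  show "At j (Box f) \<in> forms limit"
    using saturation[of m "Trs_task i f j"] m limit_formsI by (auto simp: add_def)
next
  fix i j f assume "At i (At j f) \<in> forms limit"
  then obtain m where m: "\<And>n. n \<ge> m \<Longrightarrow> At i (At j f) \<in> forms (\<Theta> n)"
    using limit_formsE by blast
  show "At j f \<in> forms limit"
    using saturation[of m "At_task i j f"] m limit_formsI by (auto simp: add_def)
next
  fix i f j assume "At i f \<in> forms limit" "At i (Nom j) \<in> forms limit" and f: "\<And>k. f \<noteq> Dia (Nom k)"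
  then obtain m where m: "\<And>n. n \<ge> m \<Longrightarrow> At i f \<in> forms (\<Theta> n) \<and> At i (Nom j) \<in> forms (\<Theta> n)"
    using limit_formsE2 by blast
  have "At i f \<notin> access (\<Theta> n)" for n
    using access_shape f by blast
  then show "At j f \<in> forms limit"
    using saturation[of m "Id_task i f j"] m limit_formsI by (auto simp: add_def)
next
  fix i j assume ij: "i \<in> branch_noms limit" "j \<in> branch_noms limit"
  obtain k where k: "\<And>n. n \<ge> k \<Longrightarrow> i \<in> branch_noms (\<Theta> n)"
    using ij(1) limit_nomsE by blast
  obtain l where l: "\<And>n. n \<ge> l \<Longrightarrow> j \<in> branch_noms (\<Theta> n)"
    using ij(2) limit_nomsE by blast
  show "At i (Dia (Nom j)) \<in> forms limit \<or> At j (Dia (Nom i)) \<in> forms limit"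
    using saturation[of "max k l" "Tot_task i j"] k l limit_formsI by (auto simp: add_access_def)
qed

end


section \<open>Completeness\<close>

lemma path_build:
  assumes "is_path (build \<Theta>) \<pi>"
  shows "\<pi> n = build (stage (\<pi> n))"
proof (induction n)
  case 0
  then show ?case using assms by (simp add: is_path_def)
next
  case (Suc n)
  have ch: "children (\<pi> n) = map build (successors (stage (\<pi> n)))"
    using Suc.IH by (metis build.sel(2))
  have "if children (\<pi> n) = [] then \<pi> (Suc n) = \<pi> n else \<pi> (Suc n) \<in> set (children (\<pi> n))"
    using assms by (simp add: is_path_def)
  then show ?case
    using Suc ch by (auto split: if_splits)
qed

lemma open_path_fair_branch:
  assumes "is_path (build (initial (At i0 \<phi>0))) \<pi>" "\<not> closed_forms (\<Union>n. forms (stage (\<pi> n)))"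
  shows "fair_branch (\<lambda>n. stage (\<pi> n)) i0 \<phi>0"
proof
  show "stage (\<pi> 0) = initial (At i0 \<phi>0)"
    using assms(1) by (simp add: is_path_def)
  show "\<not> closed_forms (\<Union>n. forms (stage (\<pi> n)))"
    by (rule assms(2))
  fix n
  have ch: "children (\<pi> n) = map build (successors (stage (\<pi> n)))"
    using path_build[OF assms(1), of n] by (metis build.sel(2))
  have "if children (\<pi> n) = [] then \<pi> (Suc n) = \<pi> n else \<pi> (Suc n) \<in> set (children (\<pi> n))"
    using assms(1) by (simp add: is_path_def)
  then show "if successors (stage (\<pi> n)) = [] then stage (\<pi> (Suc n)) = stage (\<pi> n)
    else stage (\<pi> (Suc n)) \<in> set (successors (stage (\<pi> n)))"
    using ch by (auto split: if_splits)
qed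

theorem theorem6p5:
  fixes \<phi> :: form
  assumes "infinite (UNIV :: 'w set)"
    and "\<And>(M :: 'w model) w. TO_model M \<Longrightarrow> w \<in> worlds M \<Longrightarrow> sat M w \<phi>"
  shows "provable \<phi>"
proof -
  obtain i where i: "i \<notin> noms \<phi>"
    using ex_new_if_finite[OF infinite_UNIV_nat finite_noms] by blast
  let ?t = "build (initial (At i (neg \<phi>)))"
  have "closed_tableau ?t"
    unfolding closed_tableau_def
  proof (intro allI impI, rule ccontr)
    \<comment> \<open>An open path would yield a totally ordered model with a world satisfying
      \<open>neg \<phi>\<close>, against validity.\<close>
    fix \<pi> assume "is_path ?t \<pi>" "\<not> closed_forms (\<Union>n. forms (stage (\<pi> n)))"
    then interpret fair_branch "\<lambda>n. stage (\<pi> n)" i "neg \<phi>"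
      by (rule open_path_fair_branch)
    interpret saturated "forms limit" "{j \<in> branch_noms limit. quasi_urfather limit j}"
      "branch_noms limit" i "neg \<phi>"
      by (rule saturated_limit) (simp add: neg_def is_nnf_nnf)
    show False
      using ex_countermodel[OF assms(1)] assms(2) by (auto simp: sat_neg)
  qed
  then show ?thesis
    unfolding provable_def is_tableau_def using i wf_build by force
qed

end
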